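(* Let $g:\mathbb R\to(0,\infty)$ be a differentiable probability density function with $\sup_{x\in\mathbb R}g(x)<\infty$, and suppose there is a constant $M$ such that for all $x_1,y_1\in\mathbb R$, \[ \left|-\frac{\mathrm d\log g(x_1)}{\mathrm dx_1}+\frac{\mathrm d\log g(y_1)}{\mathrm dy_1}\right|\le M|x_1-y_1| . \] For each positive integer $n$ let $\pi_n(x)=\prod_{i=1}^ng(x_i)$, $x=(x_1,\dots,x_n)\in\mathbb R^n$, and let $P_n$ be the transition kernel of the Metropolis adjusted Langevin algorithm on $\mathbb R^n$ with target density $\pi_n$ and step size $h_n>0$. Suppose that for some $\gamma>0$, $h_n<n^{-\gamma}$ for all $n$. Then, for any $\gamma'>0$, \[ \lim_{n\to\infty}n^{\gamma'}\,[1-\rho^*_{\mathrm{opt}}(P_n)]=0 . \]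
   Context: Metropolis adjusted Langevin algorithm (MALA): let $f_n=-\log\pi_n$ on $\mathbb R^n$, let $\Pi_n$ be the probability measure with density $\pi_n$, and let \[ a_n(x,y)=\min\left\{1,\frac{\pi_n(y)\exp[-\|x-y+h_n\nabla f_n(y)\|^2/(4h_n)]}{\pi_n(x)\exp[-\|y-x+h_n\nabla f_n(x)\|^2/(4h_n)]}\right\}. \] The MALA kernel with step size $h_n$ is \[ P_n(x,A)=\int_{\mathbb R^n}(4\pi h_n)^{-n/2}\exp\Big(-\tfrac1{4h_n}\|y-x+h_n\nabla f_n(x)\|^2\Big)\{a_n(x,y)1_A(y)+[1-a_n(x,y)]1_A(x)\}\,\mathrm dy \] (where $\pi$ in $(4\pi h_n)^{-n/2}$ is the numerical constant). It is reversible with respect to $\Pi_n$; it may or may not be non-negative definite. An Mtk (Markov transition kernel) is a Markov transition kernel $P:\mathsf X\times\mathcal B\to[0,1]$ on a countably generated measurable space $(\mathsf X,\mathcal B)$ (Borel $\sigma$-algebra for $\mathbb R^n$). Write $Pf(x)=\int_{\mathsf X}P(x,\mathrm dy)f(y)$, $P^m$ for the $m$-step kernel, and $\delta_xP^m=P^m(x,\cdot)$. Total variation distance: $d_{\mathrm{TV}}(\mu,\nu)=\sup_{A\in\mathcal B}[\mu(A)-\nu(A)]$. If $P$ has stationary probability measure $\Pi$, its convergence rate is \[ \rho_*(P)=\exp\Big[\sup_{x\in\mathsf X}\limsup_{m\to\infty}\frac{\log d_{\mathrm{TV}}(\delta_xP^m,\Pi)}{m}\Big]\in[0,1] \] (with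 $\log 0=-\infty$, $\exp(-\infty)=0$). Let $T_0=[0,1)\times[1,\infty)\times(0,1]\times(0,1]$. $P$ satisfies (A1)-(A3) with parameter $(\lambda,K,\varepsilon,\beta)\in T_0$ if there are $C\in\mathcal B$, a measurable $V:\mathsf X\to[1,\infty)$ and a probability measure $\nu$ on $\mathcal B$ such that: (A1) $PV(x)\le\lambda V(x)1_{\mathsf X\setminus C}(x)+K1_C(x)$ for all $x\in\mathsf X$; (A2) $P(x,A)\ge\varepsilon\nu(A)$ for all $x\in C$, $A\in\mathcal B$; (A3) $\nu(C)\ge\beta$. It is known that (A1)-(A3) imply that $P$ has a unique stationary distribution $\Pi$ and $\rho_*(P)<1$. Let $T(P)\subset T_0$ be the set of all parameters with which $P$ satisfies (A1)-(A3). $P$ is reversible if $\int g\,Pf\,\mathrm d\Pi=\int f\,Pg\,\mathrm d\Pi$ for all $f,g\in L^2(\Pi)$, and non-negative definite if $\int f\,Pf\,\mathrm d\Pi\ge0$ for all $f\in L^2(\Pi)$. Let $S^{(R)}_{\lambda,K,\varepsilon,\beta}$ be the collection of all reversible Mtks (on varying state spaces) satisfying (A1)-(A3) with parameter $(\lambda,K,\varepsilon,\beta)$, and $S^{(N)}_{\lambda,K,\varepsilon,\beta}$ the subcollection of those that are also non-negative definite. (For set-theoretic reasons, the state spaces are taken from some fixed set of measurable spaces, which includes at least all finite sets of integers.) Let $\rho^{(R)}_{\mathrm{opt}}$ and $\rho^{(N)}_{\mathrm{opt}}$ at $(\lambda,K,\varepsilon,\beta)$ be the supremum of $\rho_*(Q)$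 over $Q\in S^{(R)}_{\lambda,K,\varepsilon,\beta}$ and $Q\in S^{(N)}_{\lambda,K,\varepsilon,\beta}$ respectively. For a reversible Mtk $P$, the chain-specific optimal bound $\rho^*_{\mathrm{opt}}(P)$ is $\inf_{T(P)}\rho^{(N)}_{\mathrm{opt}}$ if $P$ is also non-negative definite, and $\inf_{T(P)}\rho^{(R)}_{\mathrm{opt}}$ otherwise; it is set equal to $1$ if $T(P)=\emptyset$. *)

theory Defs
  imports "HOL-Probability.Probability"
begin

text \<open>
  A measurable space is represented by a value of type \<open>'a measure\<close>, of which only the
  underlying set and sigma-algebra are used; \<open>P x A\<close> is \<open>emeasure (P x) A\<close>.
\<close>

definition countably_generated :: "'a measure \<Rightarrow> bool" where
  "countably_generated M \<longleftrightarrow>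
     (\<exists>G. countable G \<and> G \<subseteq> Pow (space M) \<and> sets M = sigma_sets (space M) G)"

definition Mtk :: "'a measure \<Rightarrow> ('a \<Rightarrow> 'a measure) \<Rightarrow> bool" where
  "Mtk M P \<longleftrightarrow> countably_generated M \<and> P \<in> M \<rightarrow>\<^sub>M prob_algebra M"

primrec kernel_pow :: "'a measure \<Rightarrow> ('a \<Rightarrow> 'a measure) \<Rightarrow> nat \<Rightarrow> 'a \<Rightarrow> 'a measure" where
  "kernel_pow M P 0 = return M"
| "kernel_pow M P (Suc m) = (\<lambda>x. kernel_pow M P m x \<bind> P)"

definition stationary :: "'a measure \<Rightarrow> ('a \<Rightarrow> 'a measure) \<Rightarrow> 'a measure \<Rightarrow> bool" where
  "stationary M P \<mu> \<longleftrightarrow> \<mu> \<in> space (prob_algebra M) \<and> \<mu> \<bind> P = \<mu>"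

definition L2 :: "'a measure \<Rightarrow> ('a \<Rightarrow> real) set" where
  "L2 \<mu> = {f \<in> borel_measurable \<mu>. integrable \<mu> (\<lambda>x. (f x)\<^sup>2)}"

definition kernel_app :: "('a \<Rightarrow> 'a measure) \<Rightarrow> ('a \<Rightarrow> real) \<Rightarrow> 'a \<Rightarrow> real" where
  "kernel_app P f x = (\<integral>y. f y \<partial>P x)"

definition reversible :: "('a \<Rightarrow> 'a measure) \<Rightarrow> 'a measure \<Rightarrow> bool" where
  "reversible P \<mu> \<longleftrightarrow>
     (\<forall>f\<in>L2 \<mu>. \<forall>g\<in>L2 \<mu>. (\<integral>x. g x * kernel_app P f x \<partial>\<mu>) = (\<integral>x. f x * kernel_app P g x \<partial>\<mu>))"

definition nonneg_definite :: "('a \<Rightarrow> 'a measure) \<Rightarrow> 'a measure \<Rightarrow> bool" where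
  "nonneg_definite P \<mu> \<longleftrightarrow> (\<forall>f\<in>L2 \<mu>. (\<integral>x. f x * kernel_app P f x \<partial>\<mu>) \<ge> 0)"

definition tv_dist :: "'a measure \<Rightarrow> 'a measure \<Rightarrow> real" where
  "tv_dist \<mu> \<nu> = (SUP A\<in>sets \<mu>. measure \<mu> A - measure \<nu> A)"

text \<open>
  The library has \<open>ln 0 = 0\<close> on the reals, so the conventions \<open>log 0 = -\<infinity>\<close> and
  \<open>exp (-\<infinity>) = 0\<close> are built into the two functions below. The exponential is only applied to
  values at most \<open>0\<close>; its value at \<open>\<infinity>\<close> is irrelevant.
\<close>

definition log_ereal :: "real \<Rightarrow> ereal" where
  "log_ereal t = (if t = 0 then -\<infinity> else ereal (ln t))"

definition exp_ereal :: "ereal \<Rightarrow> real" where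
  "exp_ereal a = (if a = -\<infinity> then 0 else exp (real_of_ereal a))"

definition conv_rate :: "'a measure \<Rightarrow> ('a \<Rightarrow> 'a measure) \<Rightarrow> 'a measure \<Rightarrow> real" where
  "conv_rate M P \<mu> =
     exp_ereal (SUP x\<in>space M.
       limsup (\<lambda>m. log_ereal (tv_dist (kernel_pow M P m x) \<mu>) / ereal (real m)))"

type_synonym param = "real \<times> real \<times> real \<times> real"

definition T0 :: "param set" where
  "T0 = {0..<1} \<times> {1..} \<times> {0<..1} \<times> {0<..1}"

text \<open>
  \<open>P V\<close> is a nonnegative integral here: with the Bochner integral, a \<open>V\<close> that is not
  integrable would satisfy the drift condition vacuously.
\<close>

definition A123 :: "'a measure \<Rightarrow> ('a \<Rightarrow> 'a measure) \<Rightarrow> param \<Rightarrow> bool" where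
  "A123 M P = (\<lambda>(lam, K, \<epsilon>, \<beta>). \<exists>C V \<nu>.
     C \<in> sets M \<and> V \<in> borel_measurable M \<and> (\<forall>x\<in>space M. (1::real) \<le> V x) \<and>
     \<nu> \<in> space (prob_algebra M) \<and>
     (\<forall>x\<in>space M. (\<integral>\<^sup>+y. ennreal (V y) \<partial>P x)
        \<le> ennreal (lam * V x * indicator (space M - C) x + K * indicator C x)) \<and>
     (\<forall>x\<in>C. \<forall>A\<in>sets M. measure (P x) A \<ge> \<epsilon> * measure \<nu> A) \<and>
     measure \<nu> C \<ge> \<beta>)"

definition T :: "'a measure \<Rightarrow> ('a \<Rightarrow> 'a measure) \<Rightarrow> param set" where
  "T M P = {\<theta> \<in> T0. A123 M P \<theta>}"

text \<open>
  \<open>\<S>\<close> is the fixed set of state spaces. The drift and minorization conditions determine the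
  stationary distribution, so carrying it as a third component adds no freedom.
\<close>

definition S_R :: "'a measure set \<Rightarrow> param \<Rightarrow> ('a measure \<times> ('a \<Rightarrow> 'a measure) \<times> 'a measure) set" where
  "S_R \<S> \<theta> = {(M, Q, \<mu>). M \<in> \<S> \<and> Mtk M Q \<and> stationary M Q \<mu> \<and> reversible Q \<mu> \<and> A123 M Q \<theta>}"

definition S_N :: "'a measure set \<Rightarrow> param \<Rightarrow> ('a measure \<times> ('a \<Rightarrow> 'a measure) \<times> 'a measure) set" where
  "S_N \<S> \<theta> = {(M, Q, \<mu>) \<in> S_R \<S> \<theta>. nonneg_definite Q \<mu>}"

definition rho_opt_R :: "'a measure set \<Rightarrow> param \<Rightarrow> real" where
  "rho_opt_R \<S> \<theta> = (SUP (M, Q, \<mu>)\<in>S_R \<S> \<theta>. conv_rate M Q \<mu>)"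

definition rho_opt_N :: "'a measure set \<Rightarrow> param \<Rightarrow> real" where
  "rho_opt_N \<S> \<theta> = (SUP (M, Q, \<mu>)\<in>S_N \<S> \<theta>. conv_rate M Q \<mu>)"

text \<open>
  The chain-specific optimal bound of a kernel \<open>P\<close> on \<open>M\<close>, reversible with respect to \<open>\<mu>\<close>.
  The space \<open>M\<close> may live on another type than the state spaces in \<open>\<S>\<close>.
\<close>

definition rho_opt_chain ::
  "'a measure set \<Rightarrow> 'b measure \<Rightarrow> ('b \<Rightarrow> 'b measure) \<Rightarrow> 'b measure \<Rightarrow> real" where
  "rho_opt_chain \<S> M P \<mu> =
     (if T M P = {} then 1
      else if nonneg_definite P \<mu> then INF \<theta>\<in>T M P. rho_opt_N \<S> \<theta>
      else INF \<theta>\<in>T M P. rho_opt_R \<S> \<theta>)"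

text \<open>
  As the dimension varies, points of \<open>\<real>\<^sup>n\<close> are the extensional functions on \<open>{..<n}\<close>, the
  Euclidean norm is \<open>\<lambda>x. L2_set x {..<n}\<close>, and the gradient is given by its coordinates, the
  partial derivatives.
\<close>

definition Rn :: "nat \<Rightarrow> (nat \<Rightarrow> real) measure" where
  "Rn n = (\<Pi>\<^sub>M i\<in>{..<n}. borel)"

definition lborel_n :: "nat \<Rightarrow> (nat \<Rightarrow> real) measure" where
  "lborel_n n = (\<Pi>\<^sub>M i\<in>{..<n}. lborel)"

definition grad :: "((nat \<Rightarrow> real) \<Rightarrow> real) \<Rightarrow> (nat \<Rightarrow> real) \<Rightarrow> nat \<Rightarrow> real" where
  "grad f x i = deriv (\<lambda>t. f (x(i := t))) (x i)"

definition mala_exp ::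
  "nat \<Rightarrow> ((nat \<Rightarrow> real) \<Rightarrow> real) \<Rightarrow> real \<Rightarrow> (nat \<Rightarrow> real) \<Rightarrow> (nat \<Rightarrow> real) \<Rightarrow> real" where
  "mala_exp n p h x y =
     exp (- (L2_set (\<lambda>i. y i - x i + h * grad (\<lambda>z. - ln (p z)) x i) {..<n})\<^sup>2 / (4 * h))"

definition mala_accept ::
  "nat \<Rightarrow> ((nat \<Rightarrow> real) \<Rightarrow> real) \<Rightarrow> real \<Rightarrow> (nat \<Rightarrow> real) \<Rightarrow> (nat \<Rightarrow> real) \<Rightarrow> real" where
  "mala_accept n p h x y = min 1 ((p y * mala_exp n p h y x) / (p x * mala_exp n p h x y))"

definition mala_kernel ::
  "nat \<Rightarrow> ((nat \<Rightarrow> real) \<Rightarrow> real) \<Rightarrow> real \<Rightarrow> (nat \<Rightarrow> real) \<Rightarrow> (nat \<Rightarrow> real) measure" where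
  "mala_kernel n p h x =
     measure_of (space (Rn n)) (sets (Rn n)) (\<lambda>A.
       \<integral>\<^sup>+y. ennreal ((4 * pi * h) powr (- real n / 2) * mala_exp n p h x y *
              (mala_accept n p h x y * indicator A y + (1 - mala_accept n p h x y) * indicator A x))
         \<partial>lborel_n n)"

definition prod_density :: "nat \<Rightarrow> (real \<Rightarrow> real) \<Rightarrow> (nat \<Rightarrow> real) \<Rightarrow> real" where
  "prod_density n g x = (\<Prod>i<n. g (x i))"

definition target :: "nat \<Rightarrow> ((nat \<Rightarrow> real) \<Rightarrow> real) \<Rightarrow> (nat \<Rightarrow> real) measure" where
  "target n p = density (lborel_n n) (\<lambda>x. ennreal (p x))"

end

theory Submission
  imports Defs "HOL-Real_Asymp.Real_Asymp"
begin

text \<open>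
  The gap \<open>1 - \<rho>\<close> of the optimal bound turns out to be at most \<open>2 powr (- n / 65)\<close> for all large \<open>n\<close>,
  which beats every power of \<open>n\<close>. Two facts about a parameter \<open>(lam, K, \<epsilon>, \<beta>)\<close> combine to this.

  First, \<open>lam\<close> and \<open>1 - \<epsilon>\<close> are both lower bounds of the optimal rate
  (\<open>rho_opt_N_lower_bounds\<close>). The two-point chain that is absorbed in \<open>a\<close> and stays in \<open>b\<close>
  with probability \<open>p\<close> has rate \<open>p\<close>, and it satisfies the drift and minorization conditions
  whenever \<open>p = 1 - \<epsilon>\<close> or \<open>p < lam\<close>. Its stationary distribution is a point mass, so
  reversibility and non-negative definiteness are trivial. Hence the same bound serves both
  branches of the chain-specific optimum.

  Second, for the Langevin kernel \<open>1 - lam \<le> 2 powr (- n) / \<epsilon> ^ 64\<close>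
  (\<open>drift_minorization_tradeoff\<close>), so that \<open>1 - lam\<close> and \<open>\<epsilon>\<close> cannot both exceed
  \<open>2 powr (- n / 65)\<close>. Indeed, if two points of the small set \<open>C\<close> have distance \<open>r\<close>, then their
  proposals are Gaussians of variance \<open>2 h\<close> per coordinate with centres at least \<open>r / 2\<close> apart,
  and the mass \<open>\<epsilon>\<close> common to both is at most \<open>exp (- r\<^sup>2 / (64 h))\<close>. Unless \<open>\<epsilon>\<close> is tiny, \<open>C\<close>
  therefore lies in a ball whose radius is below the typical length \<open>sqrt (2 h n)\<close> of a
  proposal step, and no starting point proposes a jump into \<open>C\<close> with more than an exponentially
  small probability. A chain that hits \<open>C\<close> with probability at most \<open>p\<close> at each step cannot
  contract a function \<open>V \<ge> 1\<close> at a rate better than \<open>1 - p\<close> outside \<open>C\<close> (\<open>drift_rate_ge\<close>).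
\<close>

section \<open>Convergence rates are at most one\<close>

lemma tv_dist_bounds:
  assumes "prob_space \<mu>" "prob_space \<nu>"
  shows measure_diff_le_tv_dist: "A \<in> sets \<mu> \<Longrightarrow> measure \<mu> A - measure \<nu> A \<le> tv_dist \<mu> \<nu>"
    and tv_dist_nonneg: "0 \<le> tv_dist \<mu> \<nu>"
    and tv_dist_le_1: "tv_dist \<mu> \<nu> \<le> 1"
proof -
  interpret \<mu>: prob_space \<mu> by fact
  have le1: "measure \<mu> A - measure \<nu> A \<le> 1" for A
    using \<mu>.prob_le_1[of A] measure_nonneg[of \<nu> A] by linarith
  then have "bdd_above ((\<lambda>A. measure \<mu> A - measure \<nu> A) ` sets \<mu>)"
    by (auto intro!: bdd_aboveI2[where M = 1])
  then show upper: "measure \<mu> A - measure \<nu> A \<le> tv_dist \<mu> \<nu>" if "A \<in> sets \<mu>" for A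
    unfolding tv_dist_def using that by (rule cSUP_upper[rotated])
  show "0 \<le> tv_dist \<mu> \<nu>"
    using upper[of "{}"] by simp
  show "tv_dist \<mu> \<nu> \<le> 1"
    unfolding tv_dist_def by (rule cSUP_least) (auto intro: le1)
qed

lemma kernel_pow_measurable:
  assumes "Mtk M P"
  shows "kernel_pow M P m \<in> M \<rightarrow>\<^sub>M prob_algebra M"
proof (induction m)
  case 0
  show ?case by simp
next
  case (Suc m)
  have "P \<in> M \<rightarrow>\<^sub>M prob_algebra M"
    using assms by (simp add: Mtk_def)
  then show ?case
    using Suc by (auto intro!: measurable_bind_prob_space)
qed

lemma prob_space_kernel_pow:
  assumes "Mtk M P" "x \<in> space M"
  shows "prob_space (kernel_pow M P m x)" "sets (kernel_pow M P m x) = sets M"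
  using measurable_space[OF kernel_pow_measurable[OF assms(1), of m] assms(2)]
  by (auto simp: space_prob_algebra)

text \<open>
  The rate applies \<open>real_of_ereal\<close> to this exponent, which is monotone only away from infinity;
  the bound excludes the value \<open>\<infinity>\<close>, which would be sent to \<open>0\<close>.
\<close>

lemma convergence_exponent_nonpos:
  assumes "Mtk M P" "stationary M P \<mu>"
  shows "(SUP x\<in>space M.
       limsup (\<lambda>m. log_ereal (tv_dist (kernel_pow M P m x) \<mu>) / ereal (real m))) \<le> 0"
proof (rule SUP_least)
  fix x assume x: "x \<in> space M"
  have \<mu>: "prob_space \<mu>"
    using assms(2) by (auto simp: stationary_def space_prob_algebra)
  have "log_ereal (tv_dist (kernel_pow M P m x) \<mu>) / ereal (real m) \<le> 0" if "m \<ge> 1" for m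
  proof -
    have "0 \<le> tv_dist (kernel_pow M P m x) \<mu>" "tv_dist (kernel_pow M P m x) \<mu> \<le> 1"
      using prob_space_kernel_pow[OF assms(1) x] \<mu> by (auto intro: tv_dist_nonneg tv_dist_le_1)
    then show ?thesis
      using that by (auto simp: log_ereal_def divide_le_0_iff)
  qed
  then show "limsup (\<lambda>m. log_ereal (tv_dist (kernel_pow M P m x) \<mu>) / ereal (real m)) \<le> 0"
    by (intro Limsup_bounded eventually_sequentiallyI[of 1]) auto
qed

lemma exp_ereal_le_1: "a \<le> 0 \<Longrightarrow> exp_ereal a \<le> 1"
  by (cases a) (auto simp: exp_ereal_def)

lemma conv_rate_nonneg: "0 \<le> conv_rate M P \<mu>"
  by (auto simp: conv_rate_def exp_ereal_def)

lemma conv_rate_le_1: "Mtk M P \<Longrightarrow> stationary M P \<mu> \<Longrightarrow> conv_rate M P \<mu> \<le> 1"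
  unfolding conv_rate_def by (intro exp_ereal_le_1 convergence_exponent_nonpos)

lemma conv_rate_ge:
  assumes M: "Mtk M P" and \<mu>: "stationary M P \<mu>" and x: "x \<in> space M" and r: "0 < r"
    and tv: "\<And>m. r ^ m \<le> tv_dist (kernel_pow M P m x) \<mu>"
  shows "r \<le> conv_rate M P \<mu>"
proof -
  let ?f = "\<lambda>x. limsup (\<lambda>m. log_ereal (tv_dist (kernel_pow M P m x) \<mu>) / ereal (real m))"
  have "ereal (ln r) \<le> log_ereal (tv_dist (kernel_pow M P m x) \<mu>) / ereal (real m)"
    if m: "m \<ge> 1" for m
  proof -
    have pos: "0 < r ^ m" using r by simp
    then have "real m * ln r \<le> ln (tv_dist (kernel_pow M P m x) \<mu>)"
      using tv[of m] r ln_le_cancel_iff[OF pos less_le_trans[OF pos tv[of m]]]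
      by (simp add: ln_realpow)
    then show ?thesis
      using m pos tv[of m] by (auto simp: log_ereal_def field_simps)
  qed
  then have "ereal (ln r) \<le> ?f x"
    by (intro le_Limsup eventually_sequentiallyI[of 1]) auto
  also have "\<dots> \<le> (SUP x\<in>space M. ?f x)"
    using x by (rule SUP_upper)
  finally have lower: "ereal (ln r) \<le> (SUP x\<in>space M. ?f x)" .
  have upper: "(SUP x\<in>space M. ?f x) \<le> 0"
    using convergence_exponent_nonpos[OF M \<mu>] .
  obtain s where s: "(SUP x\<in>space M. ?f x) = ereal s"
    using lower upper by (cases "SUP x\<in>space M. ?f x") auto
  have "ln r \<le> s" using lower s by simp
  then have "r \<le> exp s" using r by (simp add: ln_le_cancel_iff[symmetric] del: ln_le_cancel_iff)
  then show ?thesis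
    by (simp add: conv_rate_def exp_ereal_def s)
qed

section \<open>A two-point chain and the resulting lower bounds\<close>

text \<open>
  The state \<open>a\<close> is absorbing, and \<open>b\<close> is kept with probability \<open>p\<close>. Since the rate is a supremum
  over all starting points, the slow decay from \<open>b\<close> counts although \<open>b\<close> has no stationary mass.
\<close>

definition lazy_absorb :: "'a \<Rightarrow> 'a \<Rightarrow> real \<Rightarrow> 'a \<Rightarrow> 'a measure" where
  "lazy_absorb a b p x = point_measure {a, b}
     (\<lambda>y. if x = b then ennreal (if y = b then p else 1 - p) else indicator {a} y)"

context
  fixes a b :: 'a and p :: real
  assumes ab: "a \<noteq> b" and p: "0 \<le> p" "p \<le> 1"
begin

lemma sets_lazy_absorb [simp]: "sets (lazy_absorb a b p x) = Pow {a, b}"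
  by (simp add: lazy_absorb_def sets_point_measure)

lemma space_lazy_absorb [simp]: "space (lazy_absorb a b p x) = {a, b}"
  by (simp add: lazy_absorb_def space_point_measure)

lemma nn_integral_lazy_absorb:
  "(\<integral>\<^sup>+y. f y \<partial>lazy_absorb a b p x) =
     (if x = b then ennreal p * f b + ennreal (1 - p) * f a else f a)"
  using ab p by (simp add: lazy_absorb_def nn_integral_point_measure_finite add.commute)

lemma emeasure_lazy_absorb:
  assumes "A \<subseteq> {a, b}"
  shows "emeasure (lazy_absorb a b p x) A =
     (if x = b then ennreal p * indicator A b + ennreal (1 - p) * indicator A a else indicator A a)"
  using nn_integral_lazy_absorb[where f = "indicator A" and x = x] assms by simp

lemma prob_space_lazy_absorb: "prob_space (lazy_absorb a b p x)"
proof
  show "emeasure (lazy_absorb a b p x) (space (lazy_absorb a b p x)) = 1"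
    using p by (simp add: emeasure_lazy_absorb flip: ennreal_plus)
qed

lemma measure_lazy_absorb:
  assumes "A \<subseteq> {a, b}"
  shows "measure (lazy_absorb a b p x) A =
     (if x = b then p * indicator A b + (1 - p) * indicator A a else indicator A a)"
  unfolding measure_def using assms p
  by (auto simp: emeasure_lazy_absorb indicator_def simp flip: ennreal_plus)

lemma lazy_absorb_at_absorbing: "(lazy_absorb a b p) a = return (count_space {a, b}) a"
  by (rule measure_eqI) (use ab in \<open>auto simp: emeasure_lazy_absorb\<close>)

lemma Mtk_lazy_absorb: "Mtk (count_space {a, b}) (lazy_absorb a b p)"
proof -
  have "countably_generated (count_space {a, b})"
    unfolding countably_generated_def
    by (intro exI[of _ "Pow {a, b}"])
       (auto intro!: countable_finite
          simp del: Pow_insert simp: sigma_algebra.sigma_sets_eq[OF sigma_algebra_Pow])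
  then show ?thesis
    using prob_space_lazy_absorb by (auto simp: Mtk_def space_prob_algebra)
qed

lemma lazy_absorb_measurable:
  "lazy_absorb a b p \<in> count_space {a, b} \<rightarrow>\<^sub>M subprob_algebra (count_space {a, b})"
  by (rule measurable_prob_algebraD) (use Mtk_lazy_absorb in \<open>simp only: Mtk_def\<close>)

lemma stationary_lazy_absorb: "stationary (count_space {a, b}) (lazy_absorb a b p) (return (count_space {a, b}) a)"
proof -
  have "return (count_space {a, b}) a \<bind> (lazy_absorb a b p) = (lazy_absorb a b p) a"
    by (rule bind_return[OF lazy_absorb_measurable]) simp
  then show ?thesis
    by (auto simp: stationary_def space_prob_algebra lazy_absorb_at_absorbing intro!: prob_space_return)
qed

lemma integral_lazy_absorb_stationary:
  "(\<integral>x. f x * kernel_app (lazy_absorb a b p) g x \<partial>return (count_space {a, b}) a) = f a * g a"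
proof -
  have "(\<integral>x. f x * kernel_app (lazy_absorb a b p) g x \<partial>return (count_space {a, b}) a) = f a * kernel_app (lazy_absorb a b p) g a"
    by (rule integral_return) auto
  also have "kernel_app (lazy_absorb a b p) g a = g a"
    unfolding kernel_app_def lazy_absorb_at_absorbing by (rule integral_return) auto
  finally show ?thesis .
qed

lemma reversible_lazy_absorb: "reversible (lazy_absorb a b p) (return (count_space {a, b}) a)"
  by (simp add: reversible_def integral_lazy_absorb_stationary)

lemma nonneg_definite_lazy_absorb: "nonneg_definite (lazy_absorb a b p) (return (count_space {a, b}) a)"
  by (simp add: nonneg_definite_def integral_lazy_absorb_stationary)

lemma lazy_absorb_survival: "p ^ m \<le> measure (kernel_pow (count_space {a, b}) (lazy_absorb a b p) m b) {b}"
proof (induction m)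
  case 0
  show ?case by (simp add: measure_return)
next
  case (Suc m)
  note K = prob_space_kernel_pow[OF Mtk_lazy_absorb, of b m]
  interpret prob_space "kernel_pow (count_space {a, b}) (lazy_absorb a b p) m b" using K by simp
  interpret S: prob_space "kernel_pow (count_space {a, b}) (lazy_absorb a b p) (Suc m) b"
    using prob_space_kernel_pow[OF Mtk_lazy_absorb, of b "Suc m"] by simp
  have "sets (kernel_pow (count_space {a, b}) (lazy_absorb a b p) m b) = sets (count_space {a, b})"
    using K by simp
  then have meas: "(lazy_absorb a b p) \<in> kernel_pow (count_space {a, b}) (lazy_absorb a b p) m b \<rightarrow>\<^sub>M subprob_algebra (count_space {a, b})"
    using lazy_absorb_measurable by (subst measurable_cong_sets[OF _ refl])
  have "ennreal (p ^ Suc m) \<le> ennreal p * emeasure (kernel_pow (count_space {a, b}) (lazy_absorb a b p) m b) {b}"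
    using Suc p by (simp add: emeasure_eq_measure ennreal_mult mult_left_mono flip: ennreal_mult)
  also have "\<dots> = (\<integral>\<^sup>+y. ennreal p * indicator {b} y \<partial>kernel_pow (count_space {a, b}) (lazy_absorb a b p) m b)"
    using K by (subst nn_integral_cmult_indicator) auto
  also have "\<dots> \<le> (\<integral>\<^sup>+y. emeasure (lazy_absorb a b p y) {b} \<partial>kernel_pow (count_space {a, b}) (lazy_absorb a b p) m b)"
    by (rule nn_integral_mono) (auto simp: emeasure_lazy_absorb indicator_def)
  also have "\<dots> = emeasure (kernel_pow (count_space {a, b}) (lazy_absorb a b p) (Suc m) b) {b}"
    using emeasure_bind[OF not_empty meas, of "{b}"] by simp
  finally show ?case
    using p by (simp only: S.emeasure_eq_measure) (simp add: ennreal_le_iff)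
qed

lemma conv_rate_lazy_absorb: "p \<le> conv_rate (count_space {a, b}) (lazy_absorb a b p) (return (count_space {a, b}) a)"
proof (cases "p = 0")
  case True
  then show ?thesis using conv_rate_nonneg by simp
next
  case False
  show ?thesis
  proof (rule conv_rate_ge[OF Mtk_lazy_absorb stationary_lazy_absorb, of b])
    fix m
    have "p ^ m \<le> measure (kernel_pow (count_space {a, b}) (lazy_absorb a b p) m b) {b} - measure (return (count_space {a, b}) a) {b}"
      using lazy_absorb_survival[of m] ab by (simp add: measure_return)
    also have "\<dots> \<le> tv_dist (kernel_pow (count_space {a, b}) (lazy_absorb a b p) m b) (return (count_space {a, b}) a)"
      using prob_space_kernel_pow[OF Mtk_lazy_absorb, of b m]
      by (intro measure_diff_le_tv_dist prob_space_return) auto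
    finally show "p ^ m \<le> tv_dist (kernel_pow (count_space {a, b}) (lazy_absorb a b p) m b) (return (count_space {a, b}) a)" .
  qed (use False p in auto)
qed

text \<open>
  With the whole space as small set, the constant drift function works, and absorption itself
  provides the minorization by the point mass at \<open>a\<close>.
\<close>

lemma A123_lazy_absorb_minorization:
  assumes "(lam, K, \<epsilon>, \<beta>) \<in> T0" "p = 1 - \<epsilon>"
  shows "A123 (count_space {a, b}) (lazy_absorb a b p) (lam, K, \<epsilon>, \<beta>)"
  unfolding A123_def prod.case
proof (intro exI conjI)
  show "{a, b} \<in> sets (count_space {a, b})" by simp
  show "(\<lambda>_. 1) \<in> borel_measurable (count_space {a, b})" by simp
  show "return (count_space {a, b}) a \<in> space (prob_algebra (count_space {a, b}))"
    by (auto simp: space_prob_algebra intro: prob_space_return)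
  show "\<forall>x\<in>space (count_space {a, b}). (\<integral>\<^sup>+y. ennreal 1 \<partial>lazy_absorb a b p x)
      \<le> ennreal (lam * 1 * indicator (space (count_space {a, b}) - {a, b}) x + K * indicator {a, b} x)"
    using assms prob_space.emeasure_space_1[OF prob_space_lazy_absorb]
    by (auto simp: T0_def)
  show "\<forall>x\<in>{a, b}. \<forall>A\<in>sets (count_space {a, b}). \<epsilon> * measure (return (count_space {a, b}) a) A \<le> measure (lazy_absorb a b p x) A"
  proof -
    have "\<epsilon> = 1 - p" using assms by simp
    then show ?thesis
      using p by (auto simp: measure_lazy_absorb measure_return indicator_def)
  qed
  show "\<beta> \<le> measure (return (count_space {a, b}) a) {a, b}"
    using assms by (auto simp: measure_return T0_def)
qed auto

text \<open>
  With the small set \<open>{a}\<close> the minorization holds for every \<open>\<epsilon>\<close> up to \<open>1\<close>, and the drift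
  condition only concerns \<open>b\<close>: a large value of \<open>V\<close> there makes the contribution of the jump to
  \<open>a\<close> negligible, so that any \<open>p\<close> below \<open>lam\<close> is allowed.
\<close>

lemma A123_lazy_absorb_drift:
  assumes "(lam, K, \<epsilon>, \<beta>) \<in> T0" "p < lam"
  shows "A123 (count_space {a, b}) (lazy_absorb a b p) (lam, K, \<epsilon>, \<beta>)"
  unfolding A123_def prod.case
proof (intro exI conjI)
  \<comment> \<open>The value of the drift function at \<open>b\<close> solves \<open>p v + (1 - p) = lam v\<close>.\<close>
  let ?V = "\<lambda>x. if x = b then (1 - p) / (lam - p) else 1"
  have V: "1 \<le> (1 - p) / (lam - p)"
    using assms by (auto simp: T0_def field_simps)
  have eq: "p * ((1 - p) / (lam - p)) + (1 - p) = lam * ((1 - p) / (lam - p))"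
    using assms by (simp add: field_simps)
  show "{a} \<in> sets (count_space {a, b})" by simp
  show "?V \<in> borel_measurable (count_space {a, b})" by simp
  show "\<forall>x\<in>space (count_space {a, b}). 1 \<le> ?V x" using V by auto
  show "return (count_space {a, b}) a \<in> space (prob_algebra (count_space {a, b}))"
    by (auto simp: space_prob_algebra intro: prob_space_return)
  have "ennreal p * ennreal ((1 - p) / (lam - p)) + ennreal (1 - p)
      \<le> ennreal (lam * ((1 - p) / (lam - p)))"
    unfolding eq[symmetric] using p V
    by (subst ennreal_plus) (auto intro!: mult_nonneg_nonneg simp: ennreal_mult simp del: times_divide_eq_right)
  then show "\<forall>x\<in>space (count_space {a, b}). (\<integral>\<^sup>+y. ennreal (?V y) \<partial>lazy_absorb a b p x)
      \<le> ennreal (lam * ?V x * indicator (space (count_space {a, b}) - {a}) x + K * indicator {a} x)"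
    using assms ab by (auto simp: nn_integral_lazy_absorb T0_def)
  show "\<forall>x\<in>{a}. \<forall>A\<in>sets (count_space {a, b}). \<epsilon> * measure (return (count_space {a, b}) a) A \<le> measure (lazy_absorb a b p x) A"
    using assms ab by (auto simp: measure_lazy_absorb measure_return T0_def indicator_def)
  show "\<beta> \<le> measure (return (count_space {a, b}) a) {a}"
    using assms by (auto simp: measure_return T0_def)
qed

lemma lazy_absorb_in_S_N:
  assumes "(count_space {a, b}) \<in> \<S>" "A123 (count_space {a, b}) (lazy_absorb a b p) \<theta>"
  shows "((count_space {a, b}), (lazy_absorb a b p), return (count_space {a, b}) a) \<in> S_N \<S> \<theta>"
  using assms Mtk_lazy_absorb stationary_lazy_absorb reversible_lazy_absorb
    nonneg_definite_lazy_absorb by (simp add: S_N_def S_R_def)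

end

lemma S_N_subset_S_R: "S_N \<S> \<theta> \<subseteq> S_R \<S> \<theta>"
  by (auto simp: S_N_def)

text \<open>
  Membership of some chain is required because the supremum of the empty set of reals is
  unspecified; the two-point chain supplies one.
\<close>

lemma rho_opt_bounds:
  assumes "(M, Q, \<mu>) \<in> S_N \<S> \<theta>" 
  shows conv_rate_le_rho_opt_N: "conv_rate M Q \<mu> \<le> rho_opt_N \<S> \<theta>"
    and rho_opt_N_le_rho_opt_R: "rho_opt_N \<S> \<theta> \<le> rho_opt_R \<S> \<theta>"
    and rho_opt_R_le_1: "rho_opt_R \<S> \<theta> \<le> 1"
proof -
  let ?r = "\<lambda>(M, Q, \<mu>). conv_rate M Q \<mu>"
  note sub = S_N_subset_S_R[of \<S> \<theta>]
  have le1: "?r z \<le> 1" if "z \<in> S_R \<S> \<theta>" for z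
    using that by (auto simp: S_R_def intro: conv_rate_le_1)
  then have bdd: "bdd_above (?r ` S_R \<S> \<theta>)"
    by (rule bdd_aboveI2)
  show "conv_rate M Q \<mu> \<le> rho_opt_N \<S> \<theta>"
    unfolding rho_opt_N_def
    using cSUP_upper[OF assms bdd_above_mono[OF bdd image_mono[OF sub]]] by simp
  show "rho_opt_N \<S> \<theta> \<le> rho_opt_R \<S> \<theta>"
    unfolding rho_opt_N_def rho_opt_R_def
    using assms bdd sub by (intro cSUP_subset_mono) auto
  show "rho_opt_R \<S> \<theta> \<le> 1"
    unfolding rho_opt_R_def using assms sub le1 by (intro cSUP_least) blast+
qed

lemma rho_opt_N_lower_bounds:
  assumes ab: "a \<noteq> b" "count_space {a, b} \<in> \<S>" and \<theta>: "(lam, K, \<epsilon>, \<beta>) \<in> T0"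
  shows rho_opt_N_ge_minorization: "1 - \<epsilon> \<le> rho_opt_N \<S> (lam, K, \<epsilon>, \<beta>)"
    and rho_opt_N_ge_drift: "lam \<le> rho_opt_N \<S> (lam, K, \<epsilon>, \<beta>)"
    and rho_opt_R_ge_rho_opt_N: "rho_opt_N \<S> (lam, K, \<epsilon>, \<beta>) \<le> rho_opt_R \<S> (lam, K, \<epsilon>, \<beta>)"
    and rho_opt_R_bounded: "rho_opt_R \<S> (lam, K, \<epsilon>, \<beta>) \<le> 1"
proof -
  have range: "0 \<le> 1 - \<epsilon>" "1 - \<epsilon> \<le> 1" "0 \<le> lam" "lam < 1"
    using \<theta> by (auto simp: T0_def)
  have chain: "(count_space {a, b}, lazy_absorb a b (1 - \<epsilon>), return (count_space {a, b}) a)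
      \<in> S_N \<S> (lam, K, \<epsilon>, \<beta>)"
    using lazy_absorb_in_S_N[OF ab(1) range(1,2) ab(2)]
      A123_lazy_absorb_minorization[OF ab(1) range(1,2) \<theta>] by auto
  show ge: "1 - \<epsilon> \<le> rho_opt_N \<S> (lam, K, \<epsilon>, \<beta>)"
    using conv_rate_le_rho_opt_N[OF chain] conv_rate_lazy_absorb[OF ab(1) range(1,2)] by linarith
  show "rho_opt_N \<S> (lam, K, \<epsilon>, \<beta>) \<le> rho_opt_R \<S> (lam, K, \<epsilon>, \<beta>)"
    "rho_opt_R \<S> (lam, K, \<epsilon>, \<beta>) \<le> 1"
    using rho_opt_N_le_rho_opt_R[OF chain] rho_opt_R_le_1[OF chain] by auto
  show "lam \<le> rho_opt_N \<S> (lam, K, \<epsilon>, \<beta>)"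
  proof (rule dense_le)
    fix p assume "p < lam"
    show "p \<le> rho_opt_N \<S> (lam, K, \<epsilon>, \<beta>)"
    proof (cases "0 \<le> p")
      case True
      then have p: "0 \<le> p" "p \<le> 1" using \<open>p < lam\<close> range by auto
      have "(count_space {a, b}, lazy_absorb a b p, return (count_space {a, b}) a)
          \<in> S_N \<S> (lam, K, \<epsilon>, \<beta>)"
        using lazy_absorb_in_S_N[OF ab(1) p ab(2)]
          A123_lazy_absorb_drift[OF ab(1) p \<theta> \<open>p < lam\<close>] by auto
      then show ?thesis
        using conv_rate_le_rho_opt_N conv_rate_lazy_absorb[OF ab(1) p] by fastforce
    next
      case False
      then show ?thesis using ge range by linarith
    qed
  qed
qed

text \<open>
  The hypothesis on the parameters is stated as a disjunction because each parameter may be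
  defeated by either of the two lower bounds.
\<close>

lemma rho_opt_chain_bounds:
  assumes ab: "a \<noteq> b" "count_space {a, b} \<in> \<S>" and c: "c \<ge> 0"
    and T: "\<And>lam K \<epsilon> \<beta>. (lam, K, \<epsilon>, \<beta>) \<in> T0 \<Longrightarrow> A123 M P (lam, K, \<epsilon>, \<beta>) \<Longrightarrow> 1 - lam \<le> c \<or> \<epsilon> \<le> c"
  shows "1 - c \<le> rho_opt_chain \<S> M P \<mu>" "rho_opt_chain \<S> M P \<mu> \<le> 1"
proof -
  have N: "0 \<le> rho_opt_N \<S> \<theta>" "1 - c \<le> rho_opt_N \<S> \<theta>" "rho_opt_N \<S> \<theta> \<le> rho_opt_R \<S> \<theta>" "rho_opt_R \<S> \<theta> \<le> 1"
    if "\<theta> \<in> T M P" for \<theta>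
  proof -
    obtain lam K \<epsilon> \<beta> where \<theta>: "\<theta> = (lam, K, \<epsilon>, \<beta>)" by (rule prod_cases4)
    have T0: "(lam, K, \<epsilon>, \<beta>) \<in> T0" and A: "A123 M P (lam, K, \<epsilon>, \<beta>)"
      using that \<theta> by (auto simp: T_def)
    note b = rho_opt_N_lower_bounds[OF ab T0]
    show "0 \<le> rho_opt_N \<S> \<theta>" "1 - c \<le> rho_opt_N \<S> \<theta>" "rho_opt_N \<S> \<theta> \<le> rho_opt_R \<S> \<theta>" "rho_opt_R \<S> \<theta> \<le> 1"
      using b T[OF T0 A] T0 by (auto simp: \<theta> T0_def)
  qed
  have inf: "1 - c \<le> (INF \<theta>\<in>T M P. r \<theta>) \<and> (INF \<theta>\<in>T M P. r \<theta>) \<le> 1"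
    if ne: "T M P \<noteq> {}" and r: "\<And>\<theta>. \<theta> \<in> T M P \<Longrightarrow> 0 \<le> r \<theta> \<and> 1 - c \<le> r \<theta> \<and> r \<theta> \<le> 1" for r :: "param \<Rightarrow> real"
  proof
    show "1 - c \<le> (INF \<theta>\<in>T M P. r \<theta>)"
      using ne r by (intro cINF_greatest) blast+
    obtain \<theta> where \<theta>: "\<theta> \<in> T M P" using ne by blast
    have "bdd_below (r ` T M P)"
      using r by (intro bdd_belowI2[where m = 0]) blast
    then have "(INF \<theta>\<in>T M P. r \<theta>) \<le> r \<theta>"
      using \<theta> by (rule cINF_lower)
    then show "(INF \<theta>\<in>T M P. r \<theta>) \<le> 1" using r[OF \<theta>] by linarith
  qed
  have infN: "1 - c \<le> (INF \<theta>\<in>T M P. rho_opt_N \<S> \<theta>) \<and> (INF \<theta>\<in>T M P. rho_opt_N \<S> \<theta>) \<le> 1"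
    if "T M P \<noteq> {}"
    using N by (intro inf[OF that]) (meson order_trans)
  have infR: "1 - c \<le> (INF \<theta>\<in>T M P. rho_opt_R \<S> \<theta>) \<and> (INF \<theta>\<in>T M P. rho_opt_R \<S> \<theta>) \<le> 1"
    if "T M P \<noteq> {}"
    using N by (intro inf[OF that]) (meson order_trans)
  have "1 - c \<le> rho_opt_chain \<S> M P \<mu> \<and> rho_opt_chain \<S> M P \<mu> \<le> 1"
    unfolding rho_opt_chain_def
    using infN infR c by simp
  then show "1 - c \<le> rho_opt_chain \<S> M P \<mu>" "rho_opt_chain \<S> M P \<mu> \<le> 1" by auto
qed

section \<open>Drift towards a set that is hard to hit\<close>

text \<open>
  Let \<open>v\<close> be the infimum of \<open>V\<close> outside \<open>C\<close>. One step from a point \<open>x\<close> outside \<open>C\<close> stays outside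
  with probability at least \<open>1 - p\<close>, so \<open>(1 - p) * v \<le> P V x \<le> lam * V x\<close>. Taking the infimum
  over \<open>x\<close> and dividing by \<open>v \<ge> 1\<close> gives the claim.
\<close>

lemma drift_rate_ge:
  fixes V :: "'a \<Rightarrow> real"
  assumes C: "C \<in> sets M" "C \<noteq> space M" and lam: "0 \<le> lam"
    and P: "\<And>x. x \<in> space M - C \<Longrightarrow> prob_space (P x)" "\<And>x. x \<in> space M - C \<Longrightarrow> sets (P x) = sets M"
    and V: "\<And>x. x \<in> space M \<Longrightarrow> 1 \<le> V x"
    and drift: "\<And>x. x \<in> space M - C \<Longrightarrow> (\<integral>\<^sup>+y. ennreal (V y) \<partial>P x) \<le> ennreal (lam * V x)"
    and hit: "\<And>x. x \<in> space M - C \<Longrightarrow> measure (P x) C \<le> p"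
  shows "1 - lam \<le> p"
proof -
  let ?D = "space M - C"
  define v where "v = (INF x\<in>?D. V x)"
  have D: "?D \<noteq> {}" using C sets.sets_into_space by blast
  have bdd: "bdd_below (V ` ?D)" using V by (intro bdd_belowI2[where m = 1]) auto
  have v1: "1 \<le> v" unfolding v_def using D V by (intro cINF_greatest) auto
  have le: "v * (1 - p) \<le> lam * V x" if x: "x \<in> ?D" for x
  proof -
    interpret prob_space "P x" using P x by auto
    have sp: "space (P x) = space M" using P(2)[OF x] by (rule sets_eq_imp_space_eq)
    have "ennreal (v * measure (P x) ?D) = (\<integral>\<^sup>+y. ennreal v * indicator ?D y \<partial>P x)"
      using C P(2)[OF x] v1
      by (subst nn_integral_cmult_indicator) (auto simp: emeasure_eq_measure ennreal_mult)
    also have "\<dots> \<le> (\<integral>\<^sup>+y. ennreal (V y) \<partial>P x)"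
      using cINF_lower[OF bdd] sp
      by (intro nn_integral_mono) (auto simp: v_def indicator_def intro: ennreal_leI)
    also have "\<dots> \<le> ennreal (lam * V x)" by (rule drift[OF x])
    finally have "v * measure (P x) ?D \<le> lam * V x"
      using lam V[of x] x by (subst (asm) ennreal_le_iff) auto
    moreover have "measure (P x) ?D = 1 - measure (P x) C"
      using prob_compl[of C] C P(2)[OF x] sp by simp
    moreover have "v * (1 - p) \<le> v * (1 - measure (P x) C)"
      using hit[OF x] v1 by (intro mult_left_mono) auto
    ultimately show ?thesis by simp
  qed
  have "v * (1 - p) \<le> lam * v"
  proof (cases "lam = 0")
    case True
    then show ?thesis using le D by auto
  next
    case False
    then have "v * (1 - p) / lam \<le> v"
      unfolding v_def using D le lam by (intro cINF_greatest) (auto simp: field_simps v_def)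
    then show ?thesis using False lam by (simp add: field_simps)
  qed
  then have "v * (1 - p) \<le> v * lam" by (simp add: mult.commute)
  then show ?thesis using v1 by (subst (asm) mult_le_cancel_left_pos) auto
qed

section \<open>Gaussian densities\<close>

text \<open>
  The Gaussian with centre \<open>c\<close> has variance \<open>2 * h\<close> in each coordinate, which is the normalization
  of a Langevin proposal with step size \<open>h\<close>.
\<close>

definition gauss :: "nat \<Rightarrow> real \<Rightarrow> (nat \<Rightarrow> real) \<Rightarrow> (nat \<Rightarrow> real) \<Rightarrow> real" where
  "gauss n h c y = (4 * pi * h) powr (- real n / 2) * exp (- (\<Sum>i<n. (y i - c i)\<^sup>2) / (4 * h))"

lemma gauss_pos: "0 < h \<Longrightarrow> 0 < gauss n h c y"
  by (simp add: gauss_def)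

lemma sets_Rn: "sets (Rn n) = sets (lborel_n n)"
  unfolding Rn_def lborel_n_def by (intro sets_PiM_cong) auto

lemma space_Rn: "space (Rn n) = space (lborel_n n)"
  by (rule sets_eq_imp_space_eq) (rule sets_Rn)

lemma measurable_component_lborel_n [simp]:
  "i < n \<Longrightarrow> (\<lambda>y. y i) \<in> borel_measurable (lborel_n n)"
  unfolding lborel_n_def
  using measurable_component_singleton[of i "{..<n}" "\<lambda>_. lborel :: real measure"] by simp

lemma gauss_measurable [measurable]: "gauss n h c \<in> borel_measurable (lborel_n n)"
proof -
  have "(\<lambda>y. \<Sum>i<n. (y i - c i)\<^sup>2) \<in> borel_measurable (lborel_n n)"
  proof (rule borel_measurable_sum)
    fix i assume "i \<in> {..<n}"
    then have [measurable]: "(\<lambda>y. y i) \<in> borel_measurable (lborel_n n)" by simp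
    show "(\<lambda>y. (y i - c i)\<^sup>2) \<in> borel_measurable (lborel_n n)" by measurable
  qed
  moreover have "(\<lambda>s. (4 * pi * h) powr (- real n / 2) * exp (- s / (4 * h))) \<in> borel_measurable borel"
    by measurable
  ultimately show ?thesis
    unfolding gauss_def[abs_def] by (rule measurable_compose)
qed

lemma gauss_eq_prod_normal_density:
  assumes "0 < h"
  shows "gauss n h c y = (\<Prod>i<n. normal_density (c i) (sqrt (2 * h)) (y i))"
proof -
  have "(\<Prod>i<n. normal_density (c i) (sqrt (2 * h)) (y i)) =
      (\<Prod>i<n. (4 * pi * h) powr (- 1 / 2) * exp (- (y i - c i)\<^sup>2 / (4 * h)))"
    using assms by (intro prod.cong refl)
      (simp add: normal_density_def powr_minus powr_half_sqrt field_simps)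
  also have "\<dots> = ((4 * pi * h) powr (- 1 / 2)) ^ n * exp (\<Sum>i<n. - (y i - c i)\<^sup>2 / (4 * h))"
    by (simp add: prod.distrib exp_sum)
  also have "\<dots> = gauss n h c y"
    using assms by (simp add: gauss_def powr_powr sum_negf flip: powr_realpow sum_divide_distrib)
  finally show ?thesis by simp
qed

lemma nn_integral_gauss:
  assumes "0 < h"
  shows "(\<integral>\<^sup>+y. ennreal (gauss n h c y) \<partial>lborel_n n) = 1"
proof -
  interpret product_sigma_finite "\<lambda>_::nat. lborel :: real measure" by standard
  have "(\<integral>\<^sup>+y. ennreal (gauss n h c y) \<partial>lborel_n n)
      = (\<integral>\<^sup>+y. (\<Prod>i<n. ennreal (normal_density (c i) (sqrt (2 * h)) (y i))) \<partial>lborel_n n)"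
    using assms by (simp add: gauss_eq_prod_normal_density prod_ennreal)
  also have "\<dots> = (\<Prod>i<n. \<integral>\<^sup>+t. ennreal (normal_density (c i) (sqrt (2 * h)) t) \<partial>lborel)"
    unfolding lborel_n_def by (rule product_nn_integral_prod) auto
  also have "\<dots> = 1"
  proof (rule prod.neutral, rule ballI)
    fix i
    have "prob_space (density lborel (normal_density (c i) (sqrt (2 * h))))"
      using assms by (intro prob_space_normal_density) simp
    then show "(\<integral>\<^sup>+t. ennreal (normal_density (c i) (sqrt (2 * h)) t) \<partial>lborel) = 1"
      by (auto dest!: prob_space.emeasure_space_1 simp: emeasure_density)
  qed
  finally show ?thesis .
qed

lemma emeasure_singleton_lborel_n:
  assumes "n \<ge> 1" "x \<in> space (lborel_n n)"
  shows "emeasure (lborel_n n) {x} = 0" "{x} \<in> sets (lborel_n n)"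
proof -
  interpret product_sigma_finite "\<lambda>_::nat. lborel :: real measure" by standard
  have "x \<in> extensional {..<n}"
    using assms(2) by (simp add: lborel_n_def space_PiM PiE_def)
  then have eq: "{x} = PiE {..<n} (\<lambda>i. {x i})"
    by (rule PiE_singleton[symmetric])
  show "{x} \<in> sets (lborel_n n)"
    unfolding eq lborel_n_def by (intro sets_PiM_I_finite) auto
  have "emeasure (lborel_n n) {x} = (\<Prod>i<n. emeasure (lborel :: real measure) {x i})"
    unfolding eq lborel_n_def by (rule emeasure_PiM) auto
  also have "\<dots> = 0" using assms(1) by simp
  finally show "emeasure (lborel_n n) {x} = 0" .
qed

text \<open>
  The minimum of two densities is at most their geometric mean. For Gaussians with equal
  covariance the parallelogram identity turns the geometric mean into a multiple of the Gaussian
  centred at the midpoint, and the factor depends only on the distance of the centres.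
\<close>

lemma min_gauss_le:
  assumes h: "0 < h"
  shows "min (gauss n h c y) (gauss n h d y)
    \<le> exp (- (\<Sum>i<n. (c i - d i)\<^sup>2) / (16 * h)) * gauss n h (\<lambda>i. (c i + d i) / 2) y"
proof -
  let ?m = "\<lambda>i. (c i + d i) / 2"
  have "(y i - c i)\<^sup>2 + (y i - d i)\<^sup>2 = 2 * (y i - ?m i)\<^sup>2 + (c i - d i)\<^sup>2 / 2" for i
    by (simp add: power2_eq_square field_simps)
  then have sums: "(\<Sum>i<n. (y i - c i)\<^sup>2) + (\<Sum>i<n. (y i - d i)\<^sup>2)
      = 2 * (\<Sum>i<n. (y i - ?m i)\<^sup>2) + (\<Sum>i<n. (c i - d i)\<^sup>2) / 2"
    by (simp add: sum_distrib_left sum_divide_distrib flip: sum.distrib)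
  have "gauss n h c y * gauss n h d y
      = (exp (- (\<Sum>i<n. (c i - d i)\<^sup>2) / (16 * h)) * gauss n h ?m y)\<^sup>2"
  proof -
    have split: "a + b = 2 * e + f / 2 \<Longrightarrow> exp (- a / (4 * h)) * exp (- b / (4 * h))
        = (exp (- f / (16 * h)) * exp (- e / (4 * h)))\<^sup>2" for a b e f :: real
    proof -
      assume abef: "a + b = 2 * e + f / 2"
      have "- a / (4 * h) + - b / (4 * h) = - (a + b) / (4 * h)"
        by (simp add: add_divide_distrib diff_divide_distrib)
      also have "\<dots> = 2 * (- f / (16 * h) + - e / (4 * h))"
        unfolding abef using h by (simp add: field_simps)
      finally show ?thesis
        by (simp only: exp_double mult_exp_exp)
    qed
    note split[OF sums]
    then show ?thesis
      unfolding gauss_def power2_eq_square by (simp only: mult_ac)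
  qed
  moreover have "(min (gauss n h c y) (gauss n h d y))\<^sup>2 \<le> gauss n h c y * gauss n h d y"
    using gauss_pos[OF h, of n c y] gauss_pos[OF h, of n d y]
    by (auto simp: min_def power2_eq_square intro!: mult_left_mono mult_right_mono)
  ultimately have "(min (gauss n h c y) (gauss n h d y))\<^sup>2
      \<le> (exp (- (\<Sum>i<n. (c i - d i)\<^sup>2) / (16 * h)) * gauss n h ?m y)\<^sup>2" by simp
  then show ?thesis
    by (rule power2_le_imp_le) (use gauss_pos[OF h] in \<open>auto intro!: mult_nonneg_nonneg less_imp_le\<close>)
qed

section \<open>Kernels that move by Gaussian proposals\<close>

text \<open>
  Only upper bounds on the probability of reaching a set from outside enter the argument, so an
  accept-reject step, which can but remove proposed moves, is hidden in the assumption \<open>move\<close>.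
  The factor \<open>1 / 2\<close> in \<open>expanding\<close> is any fixed constant that keeps proposals from distant
  points apart.
\<close>

locale gaussian_proposal_kernel =
  fixes n :: nat and h :: real and P :: "(nat \<Rightarrow> real) \<Rightarrow> (nat \<Rightarrow> real) measure"
    and c :: "(nat \<Rightarrow> real) \<Rightarrow> nat \<Rightarrow> real"
  assumes n: "n \<ge> 1" and h: "0 < h"
    and sets_P: "\<And>x. x \<in> space (Rn n) \<Longrightarrow> sets (P x) = sets (Rn n)"
    and prob_P: "\<And>x. x \<in> space (Rn n) \<Longrightarrow> prob_space (P x)"
    and move: "\<And>x A. x \<in> space (Rn n) \<Longrightarrow> A \<in> sets (Rn n) \<Longrightarrow> x \<notin> A \<Longrightarrow>
      emeasure (P x) A \<le> (\<integral>\<^sup>+y. ennreal (gauss n h (c x) y) * indicator A y \<partial>lborel_n n)"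
    and expanding: "\<And>x y i. i < n \<Longrightarrow> \<bar>x i - y i\<bar> / 2 \<le> \<bar>c x i - c y i\<bar>"
begin

text \<open>
  Splitting the space into the region where the first proposal density is the smaller one and
  its complement bounds \<open>\<epsilon>\<close> by the integral of the pointwise minimum of the two densities.
\<close>

lemma common_mass_le:
  assumes \<nu>: "\<nu> \<in> space (prob_algebra (Rn n))" and \<epsilon>: "0 \<le> \<epsilon>" "\<epsilon> \<le> 1"
    and x: "x \<in> space (Rn n)" "\<And>A. A \<in> sets (Rn n) \<Longrightarrow> \<epsilon> * measure \<nu> A \<le> measure (P x) A"
    and y: "y \<in> space (Rn n)" "\<And>A. A \<in> sets (Rn n) \<Longrightarrow> \<epsilon> * measure \<nu> A \<le> measure (P y) A"
  shows "\<epsilon> \<le> exp (- (\<Sum>i<n. (x i - y i)\<^sup>2) / (64 * h))"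
proof (cases "x = y")
  case True
  then show ?thesis using \<epsilon> by simp
next
  case False
  interpret \<nu>: prob_space \<nu> using \<nu> by (simp add: space_prob_algebra)
  have sets_\<nu>: "sets \<nu> = sets (Rn n)" using \<nu> by (simp add: space_prob_algebra)
  then have space_\<nu>: "space \<nu> = space (Rn n)" by (rule sets_eq_imp_space_eq)
  let ?qx = "gauss n h (c x)" and ?qy = "gauss n h (c y)"
  let ?L = "lborel_n n"
  note null = emeasure_singleton_lborel_n[OF n, folded space_Rn]
  \<comment> \<open>Both kernels may have an atom at their starting point; placing \<open>x\<close> and \<open>y\<close> on the
    opposite sides keeps the atoms out of the estimate.\<close>
  define A where "A = ({z \<in> space ?L. ?qx z \<le> ?qy z} - {x}) \<union> {y}"
  have A: "A \<in> sets (Rn n)"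
    unfolding A_def sets_Rn using null(2)[OF x(1)] null(2)[OF y(1)] by (intro sets.Un sets.Diff) measurable
  have mass: "ennreal (\<epsilon> * measure \<nu> B) \<le> (\<integral>\<^sup>+z. ennreal (gauss n h (c w) z) * indicator B z \<partial>?L)"
    if "w \<in> space (Rn n)" "\<epsilon> * measure \<nu> B \<le> measure (P w) B" "B \<in> sets (Rn n)" "w \<notin> B" for w B
  proof -
    interpret prob_space "P w" by (rule prob_P[OF that(1)])
    have "ennreal (\<epsilon> * measure \<nu> B) \<le> emeasure (P w) B"
      using that(2) by (simp add: emeasure_eq_measure ennreal_leI)
    also have "\<dots> \<le> (\<integral>\<^sup>+z. ennreal (gauss n h (c w) z) * indicator B z \<partial>?L)"
      by (rule move) (use that in auto)
    finally show ?thesis .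
  qed
  have "\<epsilon> * measure \<nu> A + \<epsilon> * measure \<nu> (space (Rn n) - A) = \<epsilon>"
    using \<nu>.prob_compl[of A] A sets_\<nu> space_\<nu> by (simp add: right_diff_distrib)
  then have "ennreal \<epsilon> = ennreal (\<epsilon> * measure \<nu> A) + ennreal (\<epsilon> * measure \<nu> (space (Rn n) - A))"
    using \<epsilon> by (simp flip: ennreal_plus)
  also have "\<dots> \<le> (\<integral>\<^sup>+z. ennreal (?qx z) * indicator A z \<partial>?L)
      + (\<integral>\<^sup>+z. ennreal (?qy z) * indicator (space (Rn n) - A) z \<partial>?L)"
    using x y A False by (intro add_mono mass) (auto simp: A_def)
  also have "\<dots> = (\<integral>\<^sup>+z. ennreal (?qx z) * indicator A z
      + ennreal (?qy z) * indicator (space (Rn n) - A) z \<partial>?L)"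
    using A by (intro nn_integral_add[symmetric]) (auto simp: sets_Rn space_Rn)
  also have "\<dots> \<le> (\<integral>\<^sup>+z. ennreal (exp (- (\<Sum>i<n. (c x i - c y i)\<^sup>2) / (16 * h)))
      * ennreal (gauss n h (\<lambda>i. (c x i + c y i) / 2) z) \<partial>?L)"
  proof (rule nn_integral_mono_AE)
    have "AE z in ?L. z \<notin> {w}" if "w \<in> space (Rn n)" for w
      by (rule AE_not_in, rule null_setsI) (rule null[OF that])+
    from this[OF x(1)] this[OF y(1)]
    show "AE z in ?L. ennreal (?qx z) * indicator A z + ennreal (?qy z) * indicator (space (Rn n) - A) z
      \<le> ennreal (exp (- (\<Sum>i<n. (c x i - c y i)\<^sup>2) / (16 * h)))
      * ennreal (gauss n h (\<lambda>i. (c x i + c y i) / 2) z)"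
    proof eventually_elim
      case (elim z)
      have "ennreal (?qx z) * indicator A z + ennreal (?qy z) * indicator (space (Rn n) - A) z
          \<le> ennreal (min (?qx z) (?qy z))"
        using elim by (auto simp: A_def indicator_def space_Rn min_def)
      also have "\<dots> \<le> ennreal (exp (- (\<Sum>i<n. (c x i - c y i)\<^sup>2) / (16 * h))
          * gauss n h (\<lambda>i. (c x i + c y i) / 2) z)"
        by (intro ennreal_leI min_gauss_le h)
      finally show ?case by (simp add: ennreal_mult gauss_pos[OF h] less_imp_le)
    qed
  qed
  also have "\<dots> = ennreal (exp (- (\<Sum>i<n. (c x i - c y i)\<^sup>2) / (16 * h)))"
    by (simp add: nn_integral_cmult nn_integral_gauss[OF h])
  finally have "\<epsilon> \<le> exp (- (\<Sum>i<n. (c x i - c y i)\<^sup>2) / (16 * h))"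
    by (simp add: ennreal_le_iff)
  also have "\<dots> \<le> exp (- (\<Sum>i<n. (x i - y i)\<^sup>2) / (64 * h))"
  proof -
    have "(x i - y i)\<^sup>2 / 4 \<le> (c x i - c y i)\<^sup>2" if "i < n" for i
      using power_mono[OF expanding[OF that, of x y], of 2] by (simp add: power_divide)
    then have "(\<Sum>i<n. (x i - y i)\<^sup>2 / 4) \<le> (\<Sum>i<n. (c x i - c y i)\<^sup>2)"
      by (intro sum_mono) auto
    then show ?thesis using h by (simp add: field_simps flip: sum_divide_distrib)
  qed
  finally show ?thesis .
qed

text \<open>
  Every \<open>y\<close> in \<open>C\<close> satisfies \<open>1 \<le> exp (- (dist y x0)\<^sup>2 / h) / \<epsilon> ^ 64\<close> for a fixed \<open>x0\<close> in \<open>C\<close>,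
  by the 64th power of the bound on the common mass. This replaces the indicator of \<open>C\<close> by an
  unnormalized Gaussian with step size \<open>h / 4\<close>. The proposal density is at most its value at the
  centre, and the ratio of the normalizing constants for the step sizes \<open>h\<close> and \<open>h / 4\<close> is \<open>2 powr (- n)\<close>.
\<close>

lemma proposal_mass_small_set:
  assumes \<nu>: "\<nu> \<in> space (prob_algebra (Rn n))" and \<epsilon>: "0 < \<epsilon>" "\<epsilon> \<le> 1"
    and C: "C \<in> sets (Rn n)"
      "\<And>x A. x \<in> C \<Longrightarrow> A \<in> sets (Rn n) \<Longrightarrow> \<epsilon> * measure \<nu> A \<le> measure (P x) A"
  shows "(\<integral>\<^sup>+y. ennreal (gauss n h d y) * indicator C y \<partial>lborel_n n) \<le> ennreal (2 powr (- real n) / \<epsilon> ^ 64)"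
proof (cases "C = {}")
  case True
  then show ?thesis by simp
next
  case False
  then obtain x0 where x0: "x0 \<in> C" by auto
  have sub: "C \<subseteq> space (Rn n)" using C(1) sets.sets_into_space by auto
  have "gauss n h d y * indicator C y \<le> 2 powr (- real n) / \<epsilon> ^ 64 * gauss n (h / 4) x0 y" for y
  proof (cases "y \<in> C")
    case True
    let ?S = "\<Sum>i<n. (y i - x0 i)\<^sup>2"
    have "\<epsilon> \<le> exp (- ?S / (64 * h))"
      using True x0 sub C \<epsilon> by (intro common_mass_le[OF \<nu>]) auto
    then have "\<epsilon> ^ 64 \<le> exp (- ?S / (64 * h)) ^ 64"
      using \<epsilon> by (intro power_mono) auto
    also have "\<dots> = exp (- ?S / h)"
      using exp_of_nat_mult[of 64 "- ?S / (64 * h)"] by simp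
    finally have 1: "1 \<le> exp (- ?S / h) / \<epsilon> ^ 64"
      using \<epsilon> by simp
    have "gauss n h d y \<le> (4 * pi * h) powr (- real n / 2) * 1"
      unfolding gauss_def using h by (intro mult_left_mono) (auto intro!: divide_nonneg_pos sum_nonneg)
    also have "\<dots> \<le> (4 * pi * h) powr (- real n / 2) * (exp (- ?S / h) / \<epsilon> ^ 64)"
      using 1 by (intro mult_left_mono) auto
    also have "(4 * pi * h) powr (- real n / 2) = 2 powr (- real n) * (pi * h) powr (- real n / 2)"
    proof -
      have "(4 :: real) powr (- real n / 2) = (2 powr 2) powr (- real n / 2)" by simp
      also have "\<dots> = 2 powr (- real n)" by (simp only: powr_powr) simp
      finally show ?thesis using h by (simp add: powr_mult mult.assoc)
    qed
    finally show ?thesis using True h by (simp add: gauss_def field_simps)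
  next
    case False
    then show ?thesis using gauss_pos[of "h / 4" n x0 y] h \<epsilon> by simp
  qed
  then have "(\<integral>\<^sup>+y. ennreal (gauss n h d y) * indicator C y \<partial>lborel_n n)
      \<le> (\<integral>\<^sup>+y. ennreal (2 powr (- real n) / \<epsilon> ^ 64) * ennreal (gauss n (h / 4) x0 y) \<partial>lborel_n n)"
    using h \<epsilon> gauss_pos[OF h, of n d] gauss_pos[of "h / 4" n x0]
    by (intro nn_integral_mono)
       (auto simp: ennreal_mult[symmetric] less_imp_le ennreal_indicator[symmetric] intro!: ennreal_leI)
  also have "\<dots> = ennreal (2 powr (- real n) / \<epsilon> ^ 64)"
    using h by (simp add: nn_integral_cmult nn_integral_gauss)
  finally show ?thesis .
qed

lemma drift_minorization_tradeoff:
  assumes \<theta>: "(lam, K, \<epsilon>, \<beta>) \<in> T0" and A123: "A123 (Rn n) P (lam, K, \<epsilon>, \<beta>)"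
  shows "1 - lam \<le> 2 powr (- real n) / \<epsilon> ^ 64"
proof -
  obtain C V \<nu> where C: "C \<in> sets (Rn n)" and V: "\<And>x. x \<in> space (Rn n) \<Longrightarrow> (1::real) \<le> V x"
    and \<nu>: "\<nu> \<in> space (prob_algebra (Rn n))"
    and drift: "\<And>x. x \<in> space (Rn n) \<Longrightarrow> (\<integral>\<^sup>+y. ennreal (V y) \<partial>P x)
        \<le> ennreal (lam * V x * indicator (space (Rn n) - C) x + K * indicator C x)"
    and minor: "\<And>x A. x \<in> C \<Longrightarrow> A \<in> sets (Rn n) \<Longrightarrow> \<epsilon> * measure \<nu> A \<le> measure (P x) A"
    using A123 unfolding A123_def prod.case by blast
  have \<epsilon>: "0 < \<epsilon>" "\<epsilon> \<le> 1" and lam: "0 \<le> lam" using \<theta> by (auto simp: T0_def)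
  note small = proposal_mass_small_set[OF \<nu> \<epsilon> C minor]
  show ?thesis
  \<comment> \<open>If nothing lies outside \<open>C\<close> the drift condition is void, but then the mass bound for \<open>C\<close>
    is a bound for the total mass \<open>1\<close>, for a Gaussian with any centre.\<close>
  proof (cases "C = space (Rn n)")
    case True
    have "1 = (\<integral>\<^sup>+y. ennreal (gauss n h undefined y) * indicator C y \<partial>lborel_n n)"
      unfolding True space_Rn nn_integral_gauss[OF h, of n undefined, symmetric]
      by (intro nn_integral_cong) simp
    also have "\<dots> \<le> ennreal (2 powr (- real n) / \<epsilon> ^ 64)" by (rule small)
    finally have "1 \<le> 2 powr (- real n) / \<epsilon> ^ 64"
      using \<epsilon> by (simp del: ennreal_1 add: ennreal_1[symmetric] ennreal_le_iff)
    then show ?thesis using lam by linarith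
  next
    case False
    show ?thesis
    proof (rule drift_rate_ge[OF C False lam, of P V])
      fix x assume x: "x \<in> space (Rn n) - C"
      then interpret prob_space "P x" by (auto intro: prob_P)
      have "ennreal (measure (P x) C) \<le> (\<integral>\<^sup>+y. ennreal (gauss n h (c x) y) * indicator C y \<partial>lborel_n n)"
        using x C move[of x C] by (simp add: emeasure_eq_measure)
      also have "\<dots> \<le> ennreal (2 powr (- real n) / \<epsilon> ^ 64)" by (rule small)
      finally show "measure (P x) C \<le> 2 powr (- real n) / \<epsilon> ^ 64"
        using \<epsilon> by (simp add: ennreal_le_iff)
    qed (use V drift prob_P sets_P in \<open>force+\<close>)
  qed
qed

text \<open>
  The exponent balances the two terms: \<open>\<epsilon> = 2 powr (- n) / \<epsilon> ^ 64\<close> holds for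
  \<open>\<epsilon> = 2 powr (- n / 65)\<close>.
\<close>

lemma drift_or_minorization_exponentially_small:
  assumes \<theta>: "(lam, K, \<epsilon>, \<beta>) \<in> T0" and A123: "A123 (Rn n) P (lam, K, \<epsilon>, \<beta>)"
  shows "1 - lam \<le> 2 powr (- real n / 65) \<or> \<epsilon> \<le> 2 powr (- real n / 65)"
proof (cases "\<epsilon> \<le> 2 powr (- real n / 65)")
  case False
  then have "(2 powr (- real n / 65)) ^ 64 \<le> \<epsilon> ^ 64"
    by (intro power_mono) auto
  then have "2 powr (- real n) / \<epsilon> ^ 64 \<le> 2 powr (- real n) / (2 powr (- real n / 65)) ^ 64"
    using \<theta> by (intro divide_left_mono) (auto simp: T0_def)
  also have "\<dots> = 2 powr (- real n / 65)"
    by (simp add: powr_powr flip: powr_realpow powr_diff)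
  finally show ?thesis using drift_minorization_tradeoff[OF assms] by linarith
qed auto

end

section \<open>The Metropolis adjusted Langevin kernel\<close>

locale lipschitz_score =
  fixes g :: "real \<Rightarrow> real" and M :: real
  assumes g_pos: "\<And>t. 0 < g t"
    and g_diff: "\<And>t. g differentiable (at t)"
    and lipschitz: "\<And>s t. \<bar>- deriv (\<lambda>t. ln (g t)) s + deriv (\<lambda>t. ln (g t)) t\<bar> \<le> M * \<bar>s - t\<bar>"
begin

abbreviation "score \<equiv> deriv (\<lambda>t. ln (g t))"

lemma M_nonneg: "0 \<le> M"
  using order_trans[OF abs_ge_zero lipschitz[of 0 1]] by simp

lemma score_measurable [measurable]: "score \<in> borel_measurable borel"
proof (rule borel_measurable_continuous_onI, rule lipschitz_on_continuous_on)
  show "M-lipschitz_on UNIV score"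
    using lipschitz M_nonneg by (intro lipschitz_onI) (auto simp: dist_real_def abs_minus_commute)
qed

lemma g_measurable [measurable]: "g \<in> borel_measurable borel"
  using g_diff by (intro borel_measurable_continuous_onI)
    (auto simp: continuous_on_eq_continuous_at differentiable_imp_continuous_within)

lemma grad_neg_log_prod_density:
  assumes "i < n"
  shows "grad (\<lambda>z. - ln (prod_density n g z)) x i = - score (x i)"
proof -
  let ?K = "\<Sum>j\<in>{..<n} - {i}. ln (g (x j))"
  have eq: "ln (prod_density n g (x(i := t))) = ln (g t) + ?K" for t
  proof -
    have "ln (prod_density n g (x(i := t))) = (\<Sum>j<n. ln (g ((x(i := t)) j)))"
      unfolding prod_density_def by (rule ln_prod) (use g_pos in \<open>simp_all add: less_imp_neq[symmetric]\<close>)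
    also have "\<dots> = ln (g t) + (\<Sum>j\<in>{..<n} - {i}. ln (g ((x(i := t)) j)))"
      using assms by (subst sum.remove[of _ i]) auto
    finally show ?thesis by simp
  qed
  obtain D where D: "(g has_real_derivative D) (at (x i))"
    using g_diff by (auto simp: real_differentiable_def)
  then have ln: "((\<lambda>t. ln (g t)) has_real_derivative (D / g (x i))) (at (x i))"
    using g_pos[of "x i"] by (auto intro!: derivative_eq_intros)
  have "((\<lambda>t. - (ln (g t) + ?K)) has_real_derivative - (D / g (x i))) (at (x i))"
    by (rule derivative_eq_intros ln refl | simp)+
  then show ?thesis
    unfolding grad_def eq using DERIV_imp_deriv[OF ln] by (simp add: DERIV_imp_deriv)
qed

definition langevin_mean :: "real \<Rightarrow> (nat \<Rightarrow> real) \<Rightarrow> nat \<Rightarrow> real" where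
  "langevin_mean h x i = x i + h * score (x i)"

text \<open>
  For small steps the displacement \<open>h * score\<close> is Lipschitz with constant at most \<open>1 / 2\<close>, so adding
  it to the identity cannot bring two points closer than half their distance.
\<close>

lemma langevin_mean_expanding:
  assumes "0 < h" "h * M \<le> 1 / 2"
  shows "\<bar>x i - y i\<bar> / 2 \<le> \<bar>langevin_mean h x i - langevin_mean h y i\<bar>"
proof -
  have "\<bar>h * (score (x i) - score (y i))\<bar> \<le> h * (M * \<bar>x i - y i\<bar>)"
    using lipschitz[of "x i" "y i"] assms by (auto simp: abs_mult intro!: mult_left_mono)
  also have "\<dots> \<le> 1 / 2 * \<bar>x i - y i\<bar>"
    using mult_right_mono[OF assms(2), of "\<bar>x i - y i\<bar>"] by (simp add: mult.assoc)
  finally show ?thesis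
    unfolding langevin_mean_def right_diff_distrib by (simp add: abs_if split: if_splits)
qed

lemma mala_exp_eq:
  "mala_exp n (prod_density n g) h x y = exp (- (\<Sum>i<n. (y i - langevin_mean h x i)\<^sup>2) / (4 * h))"
proof -
  have "(\<Sum>i<n. (y i - x i + h * grad (\<lambda>z. - ln (prod_density n g z)) x i)\<^sup>2)
      = (\<Sum>i<n. (y i - langevin_mean h x i)\<^sup>2)"
    by (intro sum.cong refl) (simp add: grad_neg_log_prod_density langevin_mean_def algebra_simps)
  then show ?thesis
    by (simp add: mala_exp_def L2_set_def sum_nonneg)
qed

abbreviation "accept n h \<equiv> mala_accept n (prod_density n g) h"

lemma accept_measurable [measurable]: "accept n h x \<in> borel_measurable (lborel_n n)"
proof -
  let ?B = "borel_measurable (lborel_n n) :: ((nat \<Rightarrow> real) \<Rightarrow> real) set"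
  have [measurable]: "(\<lambda>y. \<Sum>i<n. (y i - langevin_mean h x i)\<^sup>2) \<in> ?B"
    by (intro borel_measurable_sum borel_measurable_power borel_measurable_diff) auto
  have "(\<lambda>y. score (y i)) \<in> ?B" if "i < n" for i
    by (rule measurable_compose[OF _ score_measurable]) (simp add: that)
  then have [measurable]: "(\<lambda>y. \<Sum>i<n. (x i - langevin_mean h y i)\<^sup>2) \<in> ?B"
    unfolding langevin_mean_def
    by (intro borel_measurable_sum borel_measurable_power borel_measurable_diff
        borel_measurable_add borel_measurable_times) auto
  have "(\<lambda>y. g (y i)) \<in> ?B" if "i < n" for i
    by (rule measurable_compose[OF _ g_measurable]) (simp add: that)
  then have [measurable]: "prod_density n g \<in> ?B"
    unfolding prod_density_def[abs_def] by (intro borel_measurable_prod) auto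
  show ?thesis
    unfolding mala_accept_def[abs_def] mala_exp_eq by measurable
qed

lemma accept_bounds: "0 \<le> accept n h x y" "accept n h x y \<le> 1"
proof -
  have "0 < prod_density n g z" "0 < mala_exp n (prod_density n g) h z w" for z w
    using g_pos by (auto simp: prod_density_def mala_exp_def intro: prod_pos)
  then show "0 \<le> accept n h x y" "accept n h x y \<le> 1"
    by (auto simp: mala_accept_def intro!: divide_nonneg_nonneg mult_nonneg_nonneg less_imp_le)
qed

lemma accept_split:
  assumes "0 \<le> q"
  shows "ennreal (q * accept n h x y) + ennreal (q * (1 - accept n h x y)) = ennreal q"
  using assms accept_bounds[of n h x y] by (simp add: algebra_simps mult_left_le flip: ennreal_plus)

text \<open>
  The kernel is given by a set function whose countable additivity has to be established before
  its values are known. Separating accepted from rejected proposals exhibits it as a measure with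
  a density plus a multiple of the point mass at \<open>x\<close>.
\<close>

lemma emeasure_mala_kernel:
  assumes x: "x \<in> space (Rn n)" and h: "0 < h" and A: "A \<in> sets (Rn n)"
  defines "q \<equiv> gauss n h (langevin_mean h x)"
  shows "emeasure (mala_kernel n (prod_density n g) h x) A =
      (\<integral>\<^sup>+y. ennreal (q y * accept n h x y) * indicator A y \<partial>lborel_n n) +
      (\<integral>\<^sup>+y. ennreal (q y * (1 - accept n h x y)) \<partial>lborel_n n) * indicator A x"
proof -
  let ?L = "lborel_n n"
  let ?D = "density ?L (\<lambda>y. ennreal (q y * accept n h x y))"
  let ?r = "\<integral>\<^sup>+y. ennreal (q y * (1 - accept n h x y)) \<partial>?L"
  let ?\<kappa> = "\<lambda>A. \<integral>\<^sup>+y. ennreal ((4 * pi * h) powr (- real n / 2) * mala_exp n (prod_density n g) h x y *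
              (accept n h x y * indicator A y + (1 - accept n h x y) * indicator A x)) \<partial>?L"
  have q: "q \<in> borel_measurable ?L" "\<And>y. 0 \<le> q y"
    using gauss_pos[OF h] by (auto simp: q_def less_imp_le)
  have q_eq: "(4 * pi * h) powr (- real n / 2) * mala_exp n (prod_density n g) h x y = q y" for y
    by (simp add: q_def gauss_def mala_exp_eq)
  note [measurable] = q(1)
  have \<kappa>: "?\<kappa> A = emeasure ?D A + ?r * emeasure (return ?L x) A" if "A \<in> sets (Rn n)" for A
  proof -
    have [measurable]: "A \<in> sets ?L" using that by (simp add: sets_Rn)
    have "?\<kappa> A = (\<integral>\<^sup>+y. ennreal (q y * accept n h x y) * indicator A y
        + ennreal (q y * (1 - accept n h x y)) * indicator A x \<partial>?L)"
      unfolding q_eq using q(2) accept_bounds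
      by (intro nn_integral_cong)
         (auto simp: indicator_def accept_split)
    also have "\<dots> = emeasure ?D A + ?r * indicator A x"
      by (simp add: nn_integral_add nn_integral_multc emeasure_density)
    finally show ?thesis by simp
  qed
  have "emeasure (mala_kernel n (prod_density n g) h x) A = ?\<kappa> A"
    unfolding mala_kernel_def
  proof (rule emeasure_measure_of_sigma[OF sets.sigma_algebra_axioms _ _ A])
    show "positive (sets (Rn n)) ?\<kappa>"
      by (simp add: positive_def)
    show "countably_additive (sets (Rn n)) ?\<kappa>"
    proof (rule countably_additiveI)
      fix B :: "nat \<Rightarrow> (nat \<Rightarrow> real) set"
      assume B: "range B \<subseteq> sets (Rn n)" "disjoint_family B"
      have "(\<Sum>i. ?\<kappa> (B i)) = (\<Sum>i. emeasure ?D (B i) + ?r * emeasure (return ?L x) (B i))"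
        using B by (intro suminf_cong \<kappa>) auto
      also have "\<dots> = (\<Sum>i. emeasure ?D (B i)) + ?r * (\<Sum>i. emeasure (return ?L x) (B i))"
        by (simp add: suminf_add[symmetric] ennreal_suminf_cmult)
      also have "\<dots> = emeasure ?D (\<Union>i. B i) + ?r * emeasure (return ?L x) (\<Union>i. B i)"
        using B by (intro arg_cong2[where f = "\<lambda>u v. u + ?r * v"] suminf_emeasure) (simp_all add: sets_Rn)
      also have "\<dots> = ?\<kappa> (\<Union>i. B i)"
        using B by (intro \<kappa>[symmetric]) auto
      finally show "(\<Sum>i. ?\<kappa> (B i)) = ?\<kappa> (\<Union>i. B i)" .
    qed
  qed
  then show ?thesis
    using \<kappa>[OF A] A by (simp add: emeasure_density sets_Rn)
qed

lemma gaussian_proposal_kernel_mala: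
  assumes n: "n \<ge> 1" and h: "0 < h" "h * M \<le> 1 / 2"
  shows "gaussian_proposal_kernel n h (mala_kernel n (prod_density n g) h) (langevin_mean h)"
proof (rule gaussian_proposal_kernel.intro)
  let ?P = "mala_kernel n (prod_density n g) h"
  fix x assume x: "x \<in> space (Rn n)"
  let ?q = "gauss n h (langevin_mean h x)"
  have q: "0 \<le> ?q y" for y using gauss_pos[OF h(1)] by (simp add: less_imp_le)
  show sets: "sets (?P x) = sets (Rn n)"
    by (simp add: mala_kernel_def)
  show "prob_space (?P x)"
  proof
    have "emeasure (?P x) (space (Rn n)) =
      (\<integral>\<^sup>+y. ennreal (?q y * accept n h x y) * indicator (space (Rn n)) y \<partial>lborel_n n) +
      (\<integral>\<^sup>+y. ennreal (?q y * (1 - accept n h x y)) \<partial>lborel_n n)"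
      using emeasure_mala_kernel[OF x h(1) sets.top] x by simp
    also have "\<dots> = (\<integral>\<^sup>+y. ennreal (?q y * accept n h x y) \<partial>lborel_n n) +
      (\<integral>\<^sup>+y. ennreal (?q y * (1 - accept n h x y)) \<partial>lborel_n n)"
      by (intro arg_cong2[where f = "(+)"] nn_integral_cong refl) (simp add: space_Rn)
    also have "\<dots> = (\<integral>\<^sup>+y. ennreal (?q y * accept n h x y) + ennreal (?q y * (1 - accept n h x y)) \<partial>lborel_n n)"
      by (intro nn_integral_add[symmetric]) measurable
    also have "\<dots> = (\<integral>\<^sup>+y. ennreal (?q y) \<partial>lborel_n n)"
      using q by (intro nn_integral_cong accept_split) auto
    also have "\<dots> = 1" by (rule nn_integral_gauss[OF h(1)])
    finally show "emeasure (?P x) (space (?P x)) = 1"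
      using sets_eq_imp_space_eq[OF sets] by simp
  qed
  fix A assume A: "A \<in> sets (Rn n)" "x \<notin> A"
  have "emeasure (?P x) A = (\<integral>\<^sup>+y. ennreal (?q y * accept n h x y) * indicator A y \<partial>lborel_n n)"
    using emeasure_mala_kernel[OF x h(1) A(1)] A(2) by simp
  also have "\<dots> \<le> (\<integral>\<^sup>+y. ennreal (?q y) * indicator A y \<partial>lborel_n n)"
    using q accept_bounds
    by (intro nn_integral_mono mult_right_mono ennreal_leI) (auto intro: mult_left_le)
  finally show "emeasure (?P x) A \<le> (\<integral>\<^sup>+y. ennreal (?q y) * indicator A y \<partial>lborel_n n)" .
qed (use n h langevin_mean_expanding in auto)

end

theorem proposition11:
  fixes \<S> :: "'a measure set" and emb :: "int \<Rightarrow> 'a"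
    and g :: "real \<Rightarrow> real" and M :: real and h :: "nat \<Rightarrow> real" and \<gamma> \<gamma>' :: real
  assumes emb: "inj emb"
    and finite_spaces: "\<And>F :: int set. finite F \<Longrightarrow> count_space (emb ` F) \<in> \<S>"
    and g_pos: "\<And>t. 0 < g t"
    and g_diff: "\<And>t. g differentiable (at t)"
    and g_density: "(\<integral>\<^sup>+t. ennreal (g t) \<partial>lborel) = 1"
    and g_bdd: "bdd_above (range g)"
    and lipschitz: "\<And>x1 y1. \<bar>- deriv (\<lambda>t. ln (g t)) x1 + deriv (\<lambda>t. ln (g t)) y1\<bar> \<le> M * \<bar>x1 - y1\<bar>"
    and h_pos: "\<And>n. n \<ge> 1 \<Longrightarrow> 0 < h n"
    and \<gamma>: "0 < \<gamma>"
    and h_bound: "\<And>n. n \<ge> 1 \<Longrightarrow> h n < real n powr (- \<gamma>)"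
    and \<gamma>': "0 < \<gamma>'"
  shows "(\<lambda>n. real n powr \<gamma>' *
           (1 - rho_opt_chain \<S> (Rn n) (mala_kernel n (prod_density n g) (h n))
                  (target n (prod_density n g)))) \<longlonglongrightarrow> 0"
proof -
  interpret lipschitz_score g M
    by standard (fact g_pos g_diff lipschitz)+
  let ?\<rho> = "\<lambda>n. rho_opt_chain \<S> (Rn n) (mala_kernel n (prod_density n g) (h n)) (target n (prod_density n g))"
  have ab: "emb 0 \<noteq> emb 1" "count_space {emb 0, emb 1} \<in> \<S>"
    using finite_spaces[of "{0, 1}"] by (simp_all add: inj_eq[OF emb])
  have "(\<lambda>n. real n powr (- \<gamma>) * M) \<longlonglongrightarrow> 0"
    using \<gamma> by real_asymp
  then have "eventually (\<lambda>n. real n powr (- \<gamma>) * M < 1 / 2) sequentially"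
    by (rule order_tendstoD) simp
  then have "eventually (\<lambda>n. n \<ge> 1 \<and> h n * M \<le> 1 / 2) sequentially"
    using eventually_ge_at_top[of 1]
  proof eventually_elim
    case (elim n)
    then show ?case
      using mult_right_mono[OF less_imp_le[OF h_bound[of n]] M_nonneg] by simp
  qed
  then have bounds: "eventually (\<lambda>n. 1 - 2 powr (- real n / 65) \<le> ?\<rho> n \<and> ?\<rho> n \<le> 1) sequentially"
  proof eventually_elim
    case (elim n)
    then interpret gaussian_proposal_kernel n "h n" "mala_kernel n (prod_density n g) (h n)" "langevin_mean (h n)"
      by (intro gaussian_proposal_kernel_mala h_pos) auto
    show ?case
      by (intro conjI rho_opt_chain_bounds[OF ab, of "2 powr (- real n / 65)"]
          drift_or_minorization_exponentially_small) simp_all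
  qed
  have lim: "(\<lambda>n. real n powr \<gamma>' * 2 powr (- real n / 65)) \<longlonglongrightarrow> 0"
    by real_asymp
  show ?thesis
    by (rule tendsto_sandwich[OF _ _ tendsto_const lim]; use bounds in eventually_elim)
       (auto intro!: mult_left_mono)
qed

end
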